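(* For every integer $d\geq 1$, the Ryshkov polyhedron $$\mathcal{R}=\{Q\in\mathcal{S}^d_{>0} : \langle Q, x x^t\rangle \geq 1 \text{ for all } x\in\mathbb{Z}^d\setminus\{0\}\}$$ is a locally finite polyhedron in $\mathcal{S}^d$.
   Context: $\mathcal{S}^d$ is the space of real symmetric $d\times d$ matrices, identified with real quadratic forms in $d$ variables via $Q[x]=x^tQx$, and endowed with the inner product $\langle Q,Q'\rangle=\operatorname{trace}(QQ')$, so that $Q[x]=\langle Q,xx^t\rangle$. $\mathcal{S}^d_{>0}\subset\mathcal{S}^d$ is the set of positive definite forms. The arithmetical minimum of $Q\in\mathcal{S}^d_{>0}$ is $\lambda(Q)=\min_{x\in\mathbb{Z}^d\setminus\{0\}}Q[x]$; thus $\mathcal{R}=\{Q\in\mathcal{S}^d_{>0}:\lambda(Q)\geq 1\}$. A convex polyhedron in a Euclidean space is a set defined by finitely many (non-strict) linear inequalities; a polytope is a bounded convex polyhedron (the empty set is allowed). An intersection $\mathcal{P}=\bigcap_{i=1}^\infty H_i^+$ of infinitely many (closed) halfspaces is called a locally finite polyhedron if the intersection of $\mathcal{P}$ with an arbitrary polytope is a polytope. *)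

theory Defs
  imports "HOL-Analysis.Analysis"
begin

text \<open>
  Dimension \<open>d\<close> is the cardinality of the finite index type \<open>'d\<close>; as types are
  nonempty, \<open>d \<ge> 1\<close> holds automatically.
\<close>

definition sym_forms :: "(real ^ 'd ^ 'd) set" where
  "sym_forms = {Q. transpose Q = Q}"

definition form_inner :: "real ^ 'd ^ 'd \<Rightarrow> real ^ 'd ^ 'd \<Rightarrow> real" where
  "form_inner Q Q' = trace (Q ** Q')"

definition form_value :: "real ^ 'd ^ 'd \<Rightarrow> real ^ 'd \<Rightarrow> real" where
  "form_value Q x = x \<bullet> (Q *v x)"

text \<open>The rank-one matrix \<open>x x\<^sup>t\<close>.\<close>

definition outer :: "real ^ 'd \<Rightarrow> real ^ 'd ^ 'd" where
  "outer x = (columnvector x :: real ^ 1 ^ 'd) ** (rowvector x :: real ^ 'd ^ 1)"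

definition pos_def_forms :: "(real ^ 'd ^ 'd) set" where
  "pos_def_forms = {Q \<in> sym_forms. \<forall>x. x \<noteq> 0 \<longrightarrow> form_value Q x > 0}"

definition int_vecs :: "(real ^ 'd) set" where
  "int_vecs = {x. \<forall>i. x $ i \<in> \<int>}"

definition ryshkov_polyhedron :: "(real ^ 'd ^ 'd) set" where
  "ryshkov_polyhedron =
     {Q \<in> pos_def_forms. \<forall>x \<in> int_vecs - {0}. form_inner Q (outer x) \<ge> 1}"

text \<open>
  Polyhedral notions are taken relative to a linear subspace \<open>V\<close> of a Euclidean space,
  with the restricted inner product. For \<open>V = sym_forms\<close> this is the trace inner
  product, see \<open>form_inner_eq_inner\<close> below.
\<close>

definition closed_halfspace_in :: "'a::euclidean_space set \<Rightarrow> 'a set \<Rightarrow> bool" where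
  "closed_halfspace_in V H \<longleftrightarrow> (\<exists>a \<in> V. \<exists>b. a \<noteq> 0 \<and> H = {x \<in> V. a \<bullet> x \<ge> b})"

text \<open>
  The polytopes of the Euclidean space \<open>V\<close> are exactly the polytopes of the ambient
  space that lie in \<open>V\<close>, see \<open>polytope_in_subspace_iff\<close> below. Injectivity of \<open>H\<close>
  says that there really are infinitely many halfspaces.
\<close>

definition locally_finite_polyhedron_in :: "'a::euclidean_space set \<Rightarrow> 'a set \<Rightarrow> bool" where
  "locally_finite_polyhedron_in V P \<longleftrightarrow>
     (\<exists>H :: nat \<Rightarrow> 'a set. inj H \<and> (\<forall>i. closed_halfspace_in V (H i)) \<and> P = (\<Inter>i. H i)) \<and>
     (\<forall>T. T \<subseteq> V \<and> polytope T \<longrightarrow> polytope (P \<inter> T))"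

lemma subspace_sym_forms: "subspace (sym_forms :: (real ^ 'd ^ 'd) set)"
  by (auto simp: subspace_def sym_forms_def transpose_def vec_eq_iff)

lemma form_inner_eq_inner:
  assumes "Q' \<in> sym_forms"
  shows "form_inner Q Q' = Q \<bullet> Q'"
proof -
  have "Q' $ i $ j = Q' $ j $ i" for i j
    using assms by (auto simp: sym_forms_def transpose_def vec_eq_iff)
  then show ?thesis
    by (simp add: form_inner_def trace_def matrix_matrix_mult_def inner_vec_def)
qed

lemma form_inner_outer: "form_inner Q (outer x) = form_value Q x"
  by (simp add: form_inner_def outer_def form_value_def trace_def matrix_matrix_mult_def
      columnvector_def rowvector_def matrix_vector_mult_def inner_vec_def sum_distrib_left
      algebra_simps)

lemma outer_in_sym_forms: "outer x \<in> sym_forms"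
  by (simp add: sym_forms_def outer_def transpose_def matrix_matrix_mult_def
      columnvector_def rowvector_def vec_eq_iff)

text \<open>
  Normals may be zero here: an arbitrary linear inequality, also an inconsistent one,
  is allowed in the description of a polyhedron.
\<close>

lemma polytope_in_subspace_iff:
  fixes V T :: "'a::euclidean_space set"
  assumes V: "subspace V"
  shows "T \<subseteq> V \<and> polytope T \<longleftrightarrow>
    bounded T \<and> (\<exists>I. finite I \<and> I \<subseteq> V \<times> (UNIV :: real set) \<and>
                      T = {x \<in> V. \<forall>(a, b) \<in> I. a \<bullet> x \<ge> b})"
    (is "?L \<longleftrightarrow> ?R")
proof
  assume L: ?L
  then have "polyhedron T" "bounded T"
    by (auto simp: polytope_eq_bounded_polyhedron)
  then obtain F where F: "finite F" "T = \<Inter>F"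
    "\<forall>h\<in>F. \<exists>a b. a \<noteq> 0 \<and> h = {x. a \<bullet> x \<le> b}"
    unfolding polyhedron_def by blast
  have "\<exists>a b. a \<in> V \<and> (\<forall>x\<in>V. x \<in> h \<longleftrightarrow> a \<bullet> x \<ge> b)" if "h \<in> F" for h
  proof -
    obtain a b where h: "h = {x. a \<bullet> x \<le> b}" using F(3) \<open>h \<in> F\<close> by blast
    obtain y z where yz: "y \<in> span V" "\<And>w. w \<in> span V \<Longrightarrow> orthogonal z w" "a = y + z"
      using orthogonal_subspace_decomp_exists[of V a] by metis
    have eq: "span V = V" using V by simp
    have "x \<in> h \<longleftrightarrow> (- y) \<bullet> x \<ge> - b" if "x \<in> V" for x
      using yz(2)[of x] that unfolding h eq by (simp add: yz(3) inner_add_left orthogonal_def)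
    moreover have "- y \<in> V" using yz(1) V eq by (simp add: subspace_neg)
    ultimately show ?thesis by blast
  qed
  then obtain a b where ab: "\<And>h. h \<in> F \<Longrightarrow> a h \<in> V"
    "\<And>h x. h \<in> F \<Longrightarrow> x \<in> V \<Longrightarrow> x \<in> h \<longleftrightarrow> a h \<bullet> x \<ge> b h"
    by metis
  have "T = {x \<in> V. \<forall>(u, v) \<in> (\<lambda>h. (a h, b h)) ` F. u \<bullet> x \<ge> v}"
    using L F(2) ab(2) by auto
  then show ?R
    using \<open>bounded T\<close> F(1) ab(1)
    by (intro conjI exI[of _ "(\<lambda>h. (a h, b h)) ` F"]) auto
next
  assume R: ?R
  then obtain I where I: "finite I" "T = {x \<in> V. \<forall>(a, b) \<in> I. a \<bullet> x \<ge> b}" by blast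
  have "T = V \<inter> \<Inter>((\<lambda>(a, b). {x. a \<bullet> x \<ge> b}) ` I)"
    using I(2) by auto
  moreover have "polyhedron (\<Inter>((\<lambda>(a, b). {x. a \<bullet> x \<ge> b}) ` I))"
    using I(1) by (intro polyhedron_Inter) (auto simp: polyhedron_halfspace_ge)
  moreover have "polyhedron V"
    using V by (simp add: affine_imp_polyhedron subspace_imp_affine)
  ultimately have "polyhedron T" by (simp add: polyhedron_Int)
  then show ?L using R I(2) by (auto simp: polytope_eq_bounded_polyhedron)
qed

end

theory Submission
  imports Defs
begin

text \<open>
  Each integral vector \<open>x \<noteq> 0\<close> contributes the linear condition \<open>Q[x] \<ge> 1\<close> on \<open>Q\<close>. Two things
  have to be shown: that these conditions alone describe the Ryshkov polyhedron, and that inside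
  a polytope finitely many of them suffice.

  For the former, positive definiteness must be a consequence of \<open>Q[x] \<ge> 1\<close> on the nonzero
  integral vectors. By homogeneity \<open>Q\<close> is nonnegative at rational vectors, hence everywhere.
  If a positive semidefinite \<open>Q\<close> vanished at some \<open>y \<noteq> 0\<close>, it would be small in a cylinder around
  the line through \<open>y\<close>; but by Dirichlet's theorem on simultaneous approximation such a
  cylinder, however thin, contains a nonzero integral vector. This is
  \<open>form_value_pos_if_ge_1_on_int_vecs\<close>.

  For the latter, it is enough that every form \<open>Q\<close> has a neighbourhood on which finitely many
  conditions imply all of them (\<open>locally_finitely_many_constraints\<close>); compactness of the polytope
  then does the rest (\<open>polytope_Int_locally_finite_constraints\<close>). If \<open>Q\<close> violates a condition,
  that condition fails on a whole neighbourhood and alone rules it out. Otherwise \<open>Q\<close> is positive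
  definite, so \<open>Q[x] \<ge> c |x|\<^sup>2\<close> with \<open>c > 0\<close>. Forms closer to \<open>Q\<close> than \<open>c / 2\<close> still satisfy such
  a bound with \<open>c / 2\<close>, and therefore meet the conditions for all long \<open>x\<close>; only finitely many
  integral vectors are not long.

  Finally, the halfspaces have to form an infinite sequence without repetition, which holds
  although \<open>x\<close> and \<open>-x\<close> give the same halfspace: the multiples of a coordinate vector already
  yield infinitely many (\<open>infinite_ryshkov_halfspaces\<close>).
\<close>

section \<open>Values of a form as inner products\<close>

lemma form_value_eq_inner_outer: "form_value Q x = outer x \<bullet> Q"
  using form_inner_eq_inner[OF outer_in_sym_forms] form_inner_outer
  by (metis inner_commute)

text \<open>
  The square of the norm is the value at \<open>x\<close> of the form \<open>outer x\<close>, which is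
  \<open>y \<mapsto> (x \<bullet> y)\<^sup>2\<close>.
\<close>

lemma norm_outer: "norm (outer x) = (norm x)\<^sup>2"
proof -
  have "outer x *v x = (x \<bullet> x) *\<^sub>R x"
    by (simp add: outer_def columnvector_def rowvector_def matrix_matrix_mult_def
        matrix_vector_mult_def inner_vec_def vec_eq_iff sum_distrib_left sum_distrib_right
        mult_ac)
  then have "outer x \<bullet> outer x = (norm x ^ 2) ^ 2"
    unfolding form_value_eq_inner_outer[symmetric]
    by (simp add: form_value_def dot_square_norm power2_eq_square)
  then show ?thesis
    by (simp add: norm_eq_sqrt_inner)
qed

text \<open>
  Values are Lipschitz in the form, with a constant quadratic in the vector: by linearity the
  bound also controls \<open>Q[x] - Q'[x]\<close>.
\<close>

lemma abs_form_value_le: "\<bar>form_value Q x\<bar> \<le> norm Q * (norm x)\<^sup>2"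
  using Cauchy_Schwarz_ineq2[of "outer x" Q]
  by (simp add: form_value_eq_inner_outer norm_outer mult.commute)

lemma form_value_diff: "form_value (Q - Q') x = form_value Q x - form_value Q' x"
  by (simp add: form_value_eq_inner_outer inner_diff_right)

lemma form_value_scaleR: "form_value Q (c *\<^sub>R x) = c\<^sup>2 * form_value Q x"
  by (simp add: form_value_def matrix_vector_mult_scaleR power2_eq_square)

lemma form_value_parallelogram:
  "form_value Q (x + y) + form_value Q (x - y) = 2 * form_value Q x + 2 * form_value Q y"
  by (simp add: form_value_def matrix_vector_right_distrib
      matrix_vector_mult_diff_distrib inner_add_left inner_add_right inner_diff_left
      inner_diff_right)

lemma continuous_on_form_value: "continuous_on S (form_value Q)"
  unfolding form_value_def[abs_def]
  by (intro continuous_intros linear_continuous_on_compose[OF continuous_on_id]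
      matrix_vector_mul_linear)

section \<open>Integral vectors\<close>

lemma countable_int_vecs: "countable (int_vecs :: (real ^ 'd) set)"
  unfolding int_vecs_def using countable_vector[of "\<lambda>i. \<int>"] countable_int by simp

lemma finite_int_vecs_norm_le: "finite {x \<in> (int_vecs :: (real ^ 'd) set). norm x \<le> r}"
proof (rule finite_subset)
  show "{x \<in> int_vecs. norm x \<le> r} \<subseteq> {x::real ^ 'd. \<forall>i. x $ i \<in> {k \<in> \<int>. \<bar>k\<bar> \<le> r}}"
    using component_le_norm_cart order_trans by (fastforce simp: int_vecs_def)
  show "finite {x::real ^ 'd. \<forall>i. x $ i \<in> {k \<in> \<int>. \<bar>k\<bar> \<le> r}}"
  proof (rule finite_subset)
    show "{x::real ^ 'd. \<forall>i. x $ i \<in> {k \<in> \<int>. \<bar>k\<bar> \<le> r}}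
        \<subseteq> vec_lambda ` PiE UNIV (\<lambda>_. {k \<in> \<int>. \<bar>k\<bar> \<le> r})"
      by (auto intro!: image_eqI[of _ _ "vec_nth _"])
    show "finite (vec_lambda ` PiE (UNIV :: 'd set) (\<lambda>_. {k \<in> \<int>. \<bar>k\<bar> \<le> r}))"
      by (intro finite_imageI finite_PiE finite_abs_int_segment) simp
  qed
qed

text \<open>
  Dirichlet's theorem on simultaneous approximation speaks of coordinates numbered by natural
  numbers and of the largest deviation; here it is transferred to vectors and the Euclidean norm.
  The factor \<open>q \<ge> 1\<close> prevents the trivial choice \<open>q = 0\<close>, \<open>p = 0\<close>.
\<close>

lemma int_vecs_multiple_approx:
  fixes y :: "real ^ 'd"
  assumes "\<epsilon> > 0"
  obtains q :: real and p where "q \<ge> 1" "p \<in> int_vecs" "norm (q *\<^sub>R y - p) < \<epsilon>"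
proof -
  obtain e :: "'d \<Rightarrow> nat" where e: "bij_betw e UNIV {..<CARD('d)}"
    using ex_bij_betw_finite_nat[of "UNIV :: 'd set"] by (auto simp: atLeast0LessThan)
  \<comment> \<open>The Euclidean norm is at most the sum of the coordinates, so each gets an equal share of
    \<open>\<epsilon>\<close>.\<close>
  obtain N :: nat where N: "N > 0" "1 / N < \<epsilon> / CARD('d)"
    using assms real_arch_inverse[of "\<epsilon> / CARD('d)"] by (auto simp: inverse_eq_divide)
  obtain q P where q: "q > 0" and
    P: "\<And>i. i < CARD('d) \<Longrightarrow> \<bar>of_int q * y $ inv e i - of_int (P i)\<bar> < 1 / N"
    using Dirichlet_approx_simult[OF N(1), of "CARD('d)" "\<lambda>i. y $ inv e i"] by metis
  have inv_e: "inv e (e j) = j" and e_less: "e j < CARD('d)" for j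
    using e by (auto simp: bij_betw_def)
  let ?p = "(\<chi> j. of_int (P (e j))) :: real ^ 'd"
  have "norm (of_int q *\<^sub>R y - ?p) \<le> (\<Sum>j\<in>UNIV. \<bar>(of_int q *\<^sub>R y - ?p) $ j\<bar>)"
    by (rule norm_le_l1_cart)
  also have "\<dots> < (\<Sum>j\<in>(UNIV::'d set). \<epsilon> / CARD('d))"
  proof (rule sum_strict_mono)
    fix j :: 'd
    show "\<bar>(of_int q *\<^sub>R y - ?p) $ j\<bar> < \<epsilon> / CARD('d)"
      using P[OF e_less[of j]] N(2) by (simp add: inv_e)
  qed auto
  finally have "norm (of_int q *\<^sub>R y - ?p) < \<epsilon>" by simp
  moreover have "?p \<in> int_vecs" by (simp add: int_vecs_def)
  moreover have "real_of_int q \<ge> 1" using q by simp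
  ultimately show thesis using that by blast
qed

section \<open>Positivity on integral vectors forces positive definiteness\<close>

text \<open>
  Every \<open>y\<close> is the limit of the rational vectors \<open>p k / k\<close>, where \<open>p k\<close> rounds \<open>k y\<close> down, and
  \<open>Q[p k / k] = Q[p k] / k\<^sup>2\<close>.
\<close>

lemma form_value_nonneg_if_nonneg_on_int_vecs:
  fixes y :: "real ^ 'd"
  assumes int: "\<And>x. x \<in> int_vecs \<Longrightarrow> form_value Q x \<ge> 0"
  shows "form_value Q y \<ge> 0"
proof -
  define p :: "nat \<Rightarrow> real ^ 'd" where "p k = (\<chi> i. of_int \<lfloor>real k * y $ i\<rfloor>)" for k
  have lim: "(\<lambda>k. (1 / real k) *\<^sub>R p k) \<longlonglongrightarrow> y"
  proof (rule vec_tendstoI)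
    fix i
    show "(\<lambda>k. ((1 / real k) *\<^sub>R p k) $ i) \<longlonglongrightarrow> y $ i"
    proof (rule tendsto_sandwich)
      show "\<forall>\<^sub>F k in sequentially. y $ i - 1 / real k \<le> ((1 / real k) *\<^sub>R p k) $ i"
        using eventually_gt_at_top[of 0]
      proof eventually_elim
        case (elim k)
        have "(real k * y $ i - 1) / real k \<le> of_int \<lfloor>real k * y $ i\<rfloor> / real k"
          by (intro divide_right_mono) linarith+
        then show ?case using elim by (simp add: p_def diff_divide_distrib)
      qed
      show "\<forall>\<^sub>F k in sequentially. ((1 / real k) *\<^sub>R p k) $ i \<le> y $ i"
        using eventually_gt_at_top[of 0]
      proof eventually_elim
        case (elim k)
        have "of_int \<lfloor>real k * y $ i\<rfloor> \<le> real k * y $ i" by linarith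
        then show ?case using elim by (simp add: p_def field_simps)
      qed
      show "(\<lambda>k. y $ i - 1 / real k) \<longlonglongrightarrow> y $ i"
        using tendsto_diff[OF tendsto_const lim_1_over_n] by simp
    qed simp
  qed
  have "isCont (form_value Q) y"
    using continuous_on_form_value[of UNIV Q] by (simp add: continuous_on_eq_continuous_at)
  then have "(\<lambda>k. form_value Q ((1 / real k) *\<^sub>R p k)) \<longlonglongrightarrow> form_value Q y"
    using lim by (rule isCont_tendsto_compose)
  moreover have "form_value Q ((1 / real k) *\<^sub>R p k) \<ge> 0" for k
    using int[of "p k"] by (simp add: form_value_scaleR p_def int_vecs_def)
  ultimately show ?thesis
    by (intro LIMSEQ_le_const) auto
qed

text \<open>
  Suppose \<open>Q[y] = 0\<close>, and let \<open>p = q y - \<delta>\<close> be integral with \<open>\<delta>\<close> small. Since \<open>Q\<close> is nonnegative,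
  the parallelogram law bounds \<open>Q[p]\<close> by \<open>2 Q[q y] + 2 Q[\<delta>] = 2 Q[\<delta>]\<close>, in which the possibly
  huge factor \<open>q\<close> no longer occurs. So \<open>Q[p] < 1\<close>, although \<open>p \<noteq> 0\<close>.
\<close>

lemma form_value_pos_if_ge_1_on_int_vecs:
  fixes y :: "real ^ 'd"
  assumes int: "\<And>x. x \<in> int_vecs - {0} \<Longrightarrow> form_value Q x \<ge> 1"
    and y: "y \<noteq> 0"
  shows "form_value Q y > 0"
proof -
  have nonneg: "form_value Q z \<ge> 0" for z
  proof (rule form_value_nonneg_if_nonneg_on_int_vecs)
    show "form_value Q x \<ge> 0" if "x \<in> int_vecs" for x
      using int[of x] that by (cases "x = 0") (auto simp: form_value_def)
  qed
  have "form_value Q y \<noteq> 0"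
  proof
    assume zero: "form_value Q y = 0"
    \<comment> \<open>The first bound on \<open>\<delta>\<close> keeps \<open>p\<close> away from \<open>0\<close>, the second one makes
      \<open>2 Q[\<delta>] < 1\<close>.\<close>
    define \<epsilon> where "\<epsilon> = min (norm y) (1 / (2 * (norm Q + 1)))"
    have Q1: "norm Q + 1 > 0" "norm Q + 1 \<ge> 1" using norm_ge_zero[of Q] by linarith+
    have "\<epsilon> > 0" using y Q1(1) unfolding \<epsilon>_def by (subst min_less_iff_conj) simp
    then obtain q p where qp: "q \<ge> 1" "p \<in> int_vecs" "norm (q *\<^sub>R y - p) < \<epsilon>"
      using int_vecs_multiple_approx by metis
    define \<delta> where "\<delta> = q *\<^sub>R y - p"
    have "p \<noteq> 0"
    proof
      assume "p = 0"
      then have "q * norm y < norm y" using qp by (simp add: \<epsilon>_def)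
      then show False using qp(1) mult_right_mono[of 1 q "norm y"] by simp
    qed
    have "form_value Q p \<le> form_value Q (q *\<^sub>R y - \<delta>) + form_value Q (q *\<^sub>R y + \<delta>)"
      using nonneg by (simp add: \<delta>_def)
    also have "\<dots> = 2 * form_value Q \<delta>"
      using form_value_parallelogram[of Q "q *\<^sub>R y" \<delta>] by (simp add: form_value_scaleR zero)
    also have "\<dots> \<le> 2 * (norm Q * (norm \<delta>)\<^sup>2)"
      using abs_form_value_le[of Q \<delta>] by simp
    also have "\<dots> < 1"
    proof -
      have \<delta>: "norm \<delta> < 1 / (2 * (norm Q + 1))" using qp(3) by (simp add: \<delta>_def \<epsilon>_def)
      then have a: "norm \<delta> * (2 * (norm Q + 1)) < 1" using Q1 by (simp add: field_simps)
      have "norm \<delta> \<le> 1"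
        using a Q1 mult_left_mono[of 1 "2 * (norm Q + 1)" "norm \<delta>"] by simp
      then have "(norm \<delta>)\<^sup>2 \<le> norm \<delta>" by (simp add: power2_eq_square mult_left_le)
      then have "2 * (norm Q * (norm \<delta>)\<^sup>2) \<le> 2 * (norm Q * norm \<delta>)"
        by (simp add: mult_left_mono)
      also have "\<dots> \<le> norm \<delta> * (2 * (norm Q + 1))" by (simp add: algebra_simps)
      finally show ?thesis using a by simp
    qed
    finally show False using int[of p] qp(2) \<open>p \<noteq> 0\<close> by simp
  qed
  with nonneg[of y] show ?thesis by simp
qed

lemma ryshkov_polyhedron_eq:
  "ryshkov_polyhedron = {Q \<in> sym_forms. \<forall>x \<in> int_vecs - {0}. outer x \<bullet> Q \<ge> 1}"
  using form_value_pos_if_ge_1_on_int_vecs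
  by (auto simp: ryshkov_polyhedron_def pos_def_forms_def form_inner_outer
      form_value_eq_inner_outer)

section \<open>Local finiteness\<close>

text \<open>
  The constant is the minimum of \<open>Q\<close> on the unit sphere; homogeneity extends the bound to all
  vectors.
\<close>

lemma pos_def_coercive:
  assumes pos: "\<And>x. x \<noteq> 0 \<Longrightarrow> form_value Q x > 0"
  obtains c where "c > 0" "\<And>x. c * (norm x)\<^sup>2 \<le> form_value Q x"
proof -
  obtain u where u: "u \<in> sphere 0 1" "\<And>x. x \<in> sphere 0 1 \<Longrightarrow> form_value Q u \<le> form_value Q x"
    using continuous_attains_inf[of "sphere 0 1" "form_value Q"] continuous_on_form_value
    by fastforce
  show thesis
  proof
    show "form_value Q u > 0" using u(1) by (intro pos) auto
    show "form_value Q u * (norm x)\<^sup>2 \<le> form_value Q x" for x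
    proof (cases "x = 0")
      case False
      then have "form_value Q u \<le> form_value Q ((1 / norm x) *\<^sub>R x)" by (intro u(2)) simp
      with False show ?thesis by (simp add: form_value_scaleR field_simps)
    qed (simp add: form_value_def)
  qed
qed

text \<open>
  The finite set \<open>F\<close> depends on \<open>Q\<close>: near a form violating a condition it
  consists of one vector contradicting every form nearby, and near a form of the Ryshkov
  polyhedron it collects the short vectors, where the meaning of short depends on how far
  the form is from being degenerate.
\<close>

lemma locally_finitely_many_constraints:
  fixes Q :: "real ^ 'd ^ 'd"
  obtains U and F :: "(real ^ 'd) set" where "open U" "Q \<in> U" "finite F" "F \<subseteq> int_vecs - {0}"
    "\<forall>Q'\<in>U. (\<forall>x\<in>F. outer x \<bullet> Q' \<ge> 1) \<longrightarrow> (\<forall>x\<in>int_vecs - {0}. outer x \<bullet> Q' \<ge> 1)"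
proof (cases "\<forall>x \<in> int_vecs - {0}. outer x \<bullet> Q \<ge> 1")
  case False
  then obtain x where x: "x \<in> int_vecs - {0}" "outer x \<bullet> Q < 1" by force
  show thesis
  proof
    show "open {Q'. outer x \<bullet> Q' < 1}" by (rule open_halfspace_lt)
    show "{x} \<subseteq> int_vecs - {0}" using x by simp
  qed (use x in auto)
next
  case True
  then have "form_value Q x > 0" if "x \<noteq> 0" for x
    using that by (intro form_value_pos_if_ge_1_on_int_vecs) (auto simp: form_value_eq_inner_outer)
  then obtain c where c: "c > 0" "\<And>x. c * (norm x)\<^sup>2 \<le> form_value Q x"
    using pos_def_coercive by blast
  let ?F = "{x :: real ^ 'd. x \<in> int_vecs \<and> norm x \<le> sqrt (2 / c)} - {0}"
  show thesis
  proof
    show "open (ball Q (c / 2))" "Q \<in> ball Q (c / 2)" "?F \<subseteq> int_vecs - {0}" using c by auto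
    show "finite ?F" by (simp add: finite_int_vecs_norm_le)
    show "\<forall>Q'\<in>ball Q (c / 2). (\<forall>x\<in>?F. outer x \<bullet> Q' \<ge> 1) \<longrightarrow>
        (\<forall>x\<in>int_vecs - {0}. outer x \<bullet> Q' \<ge> 1)"
    proof (intro ballI impI)
      fix Q' :: "real ^ 'd ^ 'd" and x :: "real ^ 'd"
      assume Q': "Q' \<in> ball Q (c / 2)" "\<forall>z\<in>?F. outer z \<bullet> Q' \<ge> 1" and x: "x \<in> int_vecs - {0}"
      show "outer x \<bullet> Q' \<ge> 1"
      proof (cases "norm x \<le> sqrt (2 / c)")
        case False
        then have "2 / c < (norm x)\<^sup>2" using real_le_rsqrt[of "norm x" "2 / c"] by linarith
        then have "1 \<le> c / 2 * (norm x)\<^sup>2" using c(1) by (simp add: field_simps)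
        \<comment> \<open>One half of the coercivity of \<open>Q\<close> is spent on the distance to \<open>Q'\<close>, the other half
          makes the value at least \<open>1\<close>.\<close>
        also have "\<dots> = c * (norm x)\<^sup>2 - c / 2 * (norm x)\<^sup>2" by simp
        also have "\<dots> \<le> form_value Q x - norm (Q - Q') * (norm x)\<^sup>2"
          using c(2)[of x] Q'(1) by (intro diff_mono mult_right_mono) (auto simp: dist_norm)
        also have "\<dots> \<le> form_value Q' x"
          using abs_form_value_le[of "Q - Q'" x] by (simp add: form_value_diff)
        finally show ?thesis by (simp add: form_value_eq_inner_outer)
      qed (use Q' x in auto)
    qed
  qed
qed

text \<open>
  A finite subcover of \<open>T\<close> by the given neighbourhoods selects finitely many constraints. Each
  point of \<open>T\<close> satisfying them lies in one of these neighbourhoods, whose own finite set of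
  constraints is among those selected; so the point satisfies all constraints.
\<close>

lemma polytope_Int_locally_finite_constraints:
  fixes a :: "'i \<Rightarrow> 'a::euclidean_space" and b :: "'i \<Rightarrow> real"
  assumes T: "polytope T"
    and loc: "\<And>p. p \<in> T \<Longrightarrow> \<exists>U F. open U \<and> p \<in> U \<and> finite F \<and> F \<subseteq> I \<and>
      (\<forall>q\<in>U. (\<forall>i\<in>F. a i \<bullet> q \<ge> b i) \<longrightarrow> (\<forall>i\<in>I. a i \<bullet> q \<ge> b i))"
  shows "polytope (T \<inter> {q. \<forall>i\<in>I. a i \<bullet> q \<ge> b i})"
proof -
  obtain U F where UF: "\<And>p. p \<in> T \<Longrightarrow> open (U p) \<and> p \<in> U p \<and> finite (F p) \<and> F p \<subseteq> I \<and>
      (\<forall>q\<in>U p. (\<forall>i\<in>F p. a i \<bullet> q \<ge> b i) \<longrightarrow> (\<forall>i\<in>I. a i \<bullet> q \<ge> b i))"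
    using loc by metis
  have "compact T" using T by (rule polytope_imp_compact)
  then obtain C where C: "C \<subseteq> T" "finite C" "T \<subseteq> (\<Union>p\<in>C. U p)"
    by (rule compactE_image[of T T U]) (use UF in auto)
  let ?G = "\<Union>p\<in>C. F p"
  have "T \<inter> {q. \<forall>i\<in>I. a i \<bullet> q \<ge> b i} = T \<inter> (\<Inter>i\<in>?G. {q. a i \<bullet> q \<ge> b i})" (is "?L = ?R")
  proof
    show "?L \<subseteq> ?R" using UF C(1) by blast
    show "?R \<subseteq> ?L"
    proof
      fix q assume q: "q \<in> ?R"
      then obtain p where "p \<in> C" "q \<in> U p" using C(3) by blast
      then show "q \<in> ?L" using UF[of p] C(1) q by blast
    qed
  qed
  moreover have "polyhedron (\<Inter>i\<in>?G. {q. a i \<bullet> q \<ge> b i})"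
  proof (intro polyhedron_Inter)
    have "finite ?G" using C(1,2) UF by blast
    then show "finite ((\<lambda>i. {q. a i \<bullet> q \<ge> b i}) ` ?G)" by (rule finite_imageI)
  qed (auto simp: polyhedron_halfspace_ge)
  ultimately show ?thesis using T by (simp add: polytope_Int_polyhedron)
qed

section \<open>The bounding halfspaces\<close>

text \<open>
  The halfspaces of the vectors \<open>n e\<close>, for a fixed coordinate vector \<open>e\<close> and \<open>n \<ge> 1\<close>, are
  distinguished by multiples \<open>s I\<close> of the identity matrix, whose value at \<open>n e\<close> is \<open>s n\<^sup>2\<close>.
\<close>

lemma infinite_ryshkov_halfspaces:
  "infinite ((\<lambda>x. {Q \<in> sym_forms. outer x \<bullet> Q \<ge> 1}) ` (int_vecs - {0 :: real ^ 'd}))"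
    (is "infinite (?h ` _)")
proof -
  obtain k :: 'd where True by simp
  define v where "v n = axis k (real (Suc n))" for n
  have val: "outer (v n) \<bullet> (s *\<^sub>R mat 1) = s * (real (Suc n))\<^sup>2" for n s
    by (simp add: form_value_eq_inner_outer[symmetric] form_value_def v_def
        scaleR_matrix_vector_assoc[symmetric] inner_axis_axis power2_eq_square)
  have sym: "s *\<^sub>R mat 1 \<in> (sym_forms :: (real ^ 'd ^ 'd) set)" for s
    using subspace_scale[OF subspace_sym_forms, of "mat 1"] by (simp add: sym_forms_def)
  have le: "n \<le> m" if "?h (v m) = ?h (v n)" for m n
  proof -
    \<comment> \<open>This form lies on the boundary of the halfspace of \<open>v n\<close>.\<close>
    let ?Q = "(1 / (real (Suc n))\<^sup>2) *\<^sub>R mat 1"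
    have "1 \<le> outer (v n) \<bullet> ?Q" unfolding val by (simp del: of_nat_Suc)
    then have "?Q \<in> ?h (v n)" using sym by blast
    then have "?Q \<in> ?h (v m)" using that by simp
    then have "1 \<le> outer (v m) \<bullet> ?Q" by blast
    then have "(real (Suc n))\<^sup>2 \<le> (real (Suc m))\<^sup>2"
      unfolding val by (simp add: field_simps del: of_nat_Suc)
    then have "real (Suc n) \<le> real (Suc m)" by (rule power2_le_imp_le) simp
    then show ?thesis by simp
  qed
  have "inj (\<lambda>n. ?h (v n))"
  proof (rule injI)
    fix m n assume "?h (v m) = ?h (v n)"
    from le[OF this] le[OF this[symmetric]] show "m = n" by (rule antisym[rotated])
  qed
  then have "infinite (range (\<lambda>n. ?h (v n)))" by (rule range_inj_infinite)
  moreover have "v n \<in> int_vecs - {0}" for n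
    by (auto simp: v_def int_vecs_def axis_def vec_eq_iff)
  then have "range (\<lambda>n. ?h (v n)) \<subseteq> ?h ` (int_vecs - {0})" by auto
  ultimately show ?thesis using finite_subset by blast
qed

theorem theorem3:
  shows "locally_finite_polyhedron_in (sym_forms :: (real ^ 'd ^ 'd) set)
           (ryshkov_polyhedron :: (real ^ 'd ^ 'd) set)"
  unfolding locally_finite_polyhedron_in_def
proof (intro conjI allI impI)
  let ?h = "\<lambda>x :: real ^ 'd. {Q \<in> sym_forms. outer x \<bullet> Q \<ge> 1}"
  let ?\<H> = "?h ` (int_vecs - {0})"
  have "bij_betw (from_nat_into ?\<H>) UNIV ?\<H>"
    using countable_int_vecs infinite_ryshkov_halfspaces by (intro bij_betw_from_nat_into) auto
  then have inj: "inj (from_nat_into ?\<H>)" and ran: "range (from_nat_into ?\<H>) = ?\<H>"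
    by (auto simp: bij_betw_def)
  have "closed_halfspace_in sym_forms (from_nat_into ?\<H> i)" for i
  proof -
    obtain x where x: "x \<noteq> 0" "from_nat_into ?\<H> i = ?h x" using ran by blast
    then have "outer x \<noteq> 0" using norm_outer[of x] by auto
    then show ?thesis
      using outer_in_sym_forms x(2) unfolding closed_halfspace_in_def by blast
  qed
  moreover have "ryshkov_polyhedron = (\<Inter>i. from_nat_into ?\<H> i)"
  proof -
    \<comment> \<open>Over an empty family the condition \<open>Q \<in> sym_forms\<close> would be lost in the
      intersection.\<close>
    have "axis undefined 1 \<in> int_vecs - {0 :: real ^ 'd}"
      by (auto simp: int_vecs_def axis_def vec_eq_iff)
    then have "ryshkov_polyhedron = \<Inter>?\<H>"
      unfolding ryshkov_polyhedron_eq by blast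
    then show ?thesis using ran by simp
  qed
  ultimately show "\<exists>H. inj H \<and> (\<forall>i. closed_halfspace_in sym_forms (H i)) \<and>
      (ryshkov_polyhedron :: (real ^ 'd ^ 'd) set) = (\<Inter>i::nat. H i)"
    using inj by blast
next
  fix T :: "(real ^ 'd ^ 'd) set"
  assume T: "T \<subseteq> sym_forms \<and> polytope T"
  have "polytope (T \<inter> {Q. \<forall>x\<in>int_vecs - {0}. outer x \<bullet> Q \<ge> 1})"
  proof (rule polytope_Int_locally_finite_constraints)
    show "polytope T" using T by simp
    fix Q :: "real ^ 'd ^ 'd"
    show "\<exists>U F. open U \<and> Q \<in> U \<and> finite F \<and> F \<subseteq> int_vecs - {0} \<and>
        (\<forall>Q'\<in>U. (\<forall>x\<in>F. 1 \<le> outer x \<bullet> Q') \<longrightarrow> (\<forall>x\<in>int_vecs - {0}. 1 \<le> outer x \<bullet> Q'))"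
    proof (rule locally_finitely_many_constraints[of Q], goal_cases)
      case (1 U F)
      then show ?case by (intro exI[of _ U] exI[of _ F] conjI)
    qed
  qed
  moreover have "ryshkov_polyhedron \<inter> T = T \<inter> {Q. \<forall>x\<in>int_vecs - {0}. outer x \<bullet> Q \<ge> 1}"
    using T unfolding ryshkov_polyhedron_eq by blast
  ultimately show "polytope (ryshkov_polyhedron \<inter> T)" by simp
qed

end
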